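(* Let $m,n,x,y\in\mathbb{N}=\{0,1,2,3,\ldots\}$, and let $\lambda=m\varpi_1+n\varpi_2$ and $\mu=x\varpi_1+y\varpi_2$, where $\varpi_1,\varpi_2$ are the fundamental weights of the exceptional Lie algebra $\mathfrak{g}_2$. Define the integers $$a=2m+3n-2x-3y,\quad b=m+2n-x-2y,\quad c=m+3n-2x-3y-1,$$ $$d=m+n-x-2y-1,\quad e=n-x-2y-2,\quad f=m-2x-3y-4,$$ and the polynomials $$P=\wp_q(a\alpha_1+b\alpha_2),\quad Q=\wp_q(c\alpha_1+b\alpha_2),\quad R=\wp_q(a\alpha_1+d\alpha_2),\quad S=\wp_q(c\alpha_1+e\alpha_2),\quad T=\wp_q(f\alpha_1+d\alpha_2).$$ Then $$m_q(\lambda,\mu)=\begin{cases} P-Q-R+S+T & \text{if } a,b,c,d,e,f\in\mathbb{N},\\ P-Q-R+S & \text{if } a,b,c,d,e\in\mathbb{N},\ f\notin\mathbb{N},\\ P-Q-R+T & \text{if } a,b,c,d,f\in\mathbb{N},\ e\notin\mathbb{N},\\ P-Q-R & \text{if } a,b,c,d\in\mathbb{N},\ e,f\notin\mathbb{N},\\ P-Q & \text{if } a,b,c\in\mathbb{N},\ d,e,f\notin\mathbb{N},\\ P-R & \text{if } a,b,d\in\mathbb{N},\ c,e,f\notin\mathbb{N},\\ P & \text{if } a,b\in\mathbb{N},\ c,d,e,f\notin\mathbb{N},\\ 0 & \text{otherwise.} \end{cases}$$ Moreover, for each of the first seven lines, the stated condition on $a,b,c,d,e,f$ holds if and only if the terms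 among $P,Q,R,S,T$ that are nonzero polynomials are exactly those appearing in the formula on that line; and none of the first seven conditions holds if and only if $P=Q=R=S=T=0$.
   Context: Simple roots of $\mathfrak{g}_2$ are $\alpha_1,\alpha_2$; the positive roots are $\Phi^+=\{\alpha_1,\ \alpha_2,\ \alpha_1+\alpha_2,\ 2\alpha_1+\alpha_2,\ 3\alpha_1+\alpha_2,\ 3\alpha_1+2\alpha_2\}$. The fundamental weights are $\varpi_1=2\alpha_1+\alpha_2$ and $\varpi_2=3\alpha_1+2\alpha_2$, and $\rho=\frac12\sum_{\alpha\in\Phi^+}\alpha=\varpi_1+\varpi_2=5\alpha_1+3\alpha_2$. The Weyl group $W$ (dihedral of order 12) is generated by the reflections $s_1,s_2$ acting linearly by $s_1(\alpha_1)=-\alpha_1$, $s_1(\alpha_2)=3\alpha_1+\alpha_2$, $s_2(\alpha_1)=\alpha_1+\alpha_2$, $s_2(\alpha_2)=-\alpha_2$; $\ell(\sigma)$ is the length of $\sigma\in W$ with respect to $s_1,s_2$. The $q$-analog of Kostant's partition function is the polynomial $\wp_q(\xi)=\sum_{i\ge 0}c_iq^i$ in the indeterminate $q$, where $c_i$ is the number of ways to write the weight $\xi$ as a sum of exactly $i$ positive roots (order irrelevant, repetitions allowed, i.e. multisets of $i$ positive roots with sum $\xi$). In particular $\wp_q(0)=1$, and $\wp_q(\xi)=0$ if $\xi$ is not a nonnegative integral combination of positive roots. Kostant's weight $q$-multiplicity formula is the definition $$m_q(\lambda,\mu)=\sum_{\sigma\in W}(-1)^{\ell(\sigma)}\wp_q(\sigma(\lambda+\rho)-(\mu+\rho)).$$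 *)

theory Defs
  imports
    "HOL-Analysis.Product_Vector"
    "HOL-Library.Multiset"
    "HOL-Computational_Algebra.Polynomial"
    "HOL-Algebra.Bij"
    "HOL-Algebra.Generated_Groups"
begin

text \<open>
  The real span of the roots of \<open>\<gg>\<^sub>2\<close> is identified with \<open>\<real> \<times> \<real>\<close> by taking
  coordinates with respect to the basis of simple roots.
\<close>

type_synonym weight = "real \<times> real"

definition alpha1 :: weight where "alpha1 = (1, 0)"

definition alpha2 :: weight where "alpha2 = (0, 1)"

definition pos_roots :: "weight set" where
  "pos_roots = {alpha1, alpha2, alpha1 + alpha2, 2 *\<^sub>R alpha1 + alpha2,
     3 *\<^sub>R alpha1 + alpha2, 3 *\<^sub>R alpha1 + 2 *\<^sub>R alpha2}"

definition varpi1 :: weight where "varpi1 = 2 *\<^sub>R alpha1 + alpha2"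

definition varpi2 :: weight where "varpi2 = 3 *\<^sub>R alpha1 + 2 *\<^sub>R alpha2"

definition rho :: weight where "rho = (1 / 2) *\<^sub>R (\<Sum>\<alpha>\<in>pos_roots. \<alpha>)"

text \<open>
  The simple reflections are the linear extensions of their values on \<^term>\<open>alpha1\<close>
  and \<^term>\<open>alpha2\<close>.
\<close>

definition s1 :: "weight \<Rightarrow> weight" where
  "s1 v = fst v *\<^sub>R (- alpha1) + snd v *\<^sub>R (3 *\<^sub>R alpha1 + alpha2)"

definition s2 :: "weight \<Rightarrow> weight" where
  "s2 v = fst v *\<^sub>R (alpha1 + alpha2) + snd v *\<^sub>R (- alpha2)"

definition weyl_group :: "(weight \<Rightarrow> weight) set" where
  "weyl_group = generate (BijGroup UNIV) {s1, s2}"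

definition weyl_length :: "(weight \<Rightarrow> weight) \<Rightarrow> nat" where
  "weyl_length \<sigma> =
     (LEAST k. \<exists>ws. set ws \<subseteq> {s1, s2} \<and> length ws = k \<and> \<sigma> = foldr (\<circ>) ws id)"

definition kostant_partitions :: "nat \<Rightarrow> weight \<Rightarrow> weight multiset set" where
  "kostant_partitions i \<xi> = {M. set_mset M \<subseteq> pos_roots \<and> size M = i \<and> \<Sum>\<^sub># M = \<xi>}"

definition kostant_q :: "weight \<Rightarrow> int poly" where
  "kostant_q \<xi> = Abs_poly (\<lambda>i. int (card (kostant_partitions i \<xi>)))"

definition q_mult :: "weight \<Rightarrow> weight \<Rightarrow> int poly" where
  "q_mult lam mu =
     (\<Sum>\<sigma>\<in>weyl_group. (-1) ^ weyl_length \<sigma> * kostant_q (\<sigma> (lam + rho) - (mu + rho)))"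

lemma rho_eq: "rho = varpi1 + varpi2" "rho = 5 *\<^sub>R alpha1 + 3 *\<^sub>R alpha2"
  by (simp_all add: rho_def pos_roots_def varpi1_def varpi2_def alpha1_def alpha2_def)

lemma reflections_linear: "linear s1" "linear s2"
  by (auto intro!: linearI simp: s1_def s2_def alpha1_def alpha2_def algebra_simps)

lemma reflections_simple_roots:
  "s1 alpha1 = - alpha1" "s1 alpha2 = 3 *\<^sub>R alpha1 + alpha2"
  "s2 alpha1 = alpha1 + alpha2" "s2 alpha2 = - alpha2"
  by (simp_all add: s1_def s2_def alpha1_def alpha2_def)

lemma reflections_involutive: "s1 \<circ> s1 = id" "s2 \<circ> s2 = id"
  by (simp_all add: fun_eq_iff s1_def s2_def alpha1_def alpha2_def)

lemma reflections_Bij: "s1 \<in> Bij UNIV" "s2 \<in> Bij UNIV"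
  using reflections_involutive by (simp_all add: Bij_def o_bij)

lemma BijGroup_UNIV:
  "\<one>\<^bsub>BijGroup UNIV\<^esub> = id" "carrier (BijGroup UNIV) = Bij UNIV"
  "g \<in> Bij UNIV \<Longrightarrow> h \<in> Bij UNIV \<Longrightarrow> g \<otimes>\<^bsub>BijGroup UNIV\<^esub> h = g \<circ> h"
  by (simp_all add: BijGroup_def compose_def fun_eq_iff)

lemma inv_reflections: "inv\<^bsub>BijGroup UNIV\<^esub> s1 = s1" "inv\<^bsub>BijGroup UNIV\<^esub> s2 = s2"
  by (rule group.inv_equality[OF group_BijGroup];
      simp add: BijGroup_UNIV reflections_Bij reflections_involutive)+

text \<open>
  Every element of the Weyl group is a word in the simple reflections, so the set of lengths
  in \<^term>\<open>weyl_length\<close> is nonempty there.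
\<close>

lemma weyl_group_eq_words: "weyl_group = {foldr (\<circ>) ws id | ws. set ws \<subseteq> {s1, s2}}"
proof
  show "weyl_group \<subseteq> {foldr (\<circ>) ws id | ws. set ws \<subseteq> {s1, s2}}"
  proof
    fix w assume "w \<in> weyl_group"
    then have "w \<in> Bij UNIV \<and> (\<exists>ws. set ws \<subseteq> {s1, s2} \<and> w = foldr (\<circ>) ws id)"
      unfolding weyl_group_def
    proof (induction rule: generate.induct)
      case one
      have "id \<in> Bij UNIV" by (simp add: Bij_def)
      moreover have "set [] \<subseteq> {s1, s2} \<and> id = foldr (\<circ>) [] id" by simp
      ultimately show ?case unfolding BijGroup_UNIV(1) by blast
    next
      case (incl h)
      then show ?case using reflections_Bij by (auto intro: exI[of _ "[h]"])
    next
      case (inv h)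
      then show ?case
        using reflections_Bij by (auto simp: inv_reflections intro: exI[of _ "[h]"])
    next
      case (eng g h)
      then obtain us vs where us: "set us \<subseteq> {s1, s2}" "g = foldr (\<circ>) us id"
        and vs: "set vs \<subseteq> {s1, s2}" "h = foldr (\<circ>) vs id" by blast
      have append: "foldr (\<circ>) us id \<circ> k = foldr (\<circ>) us k" for k :: "weight \<Rightarrow> weight"
        by (induction us) (simp_all add: fun_eq_iff)
      have "g \<circ> h = foldr (\<circ>) (us @ vs) id"
        using us vs append by simp
      moreover have "set (us @ vs) \<subseteq> {s1, s2}" using us vs by simp
      moreover have "g \<circ> h \<in> Bij UNIV"
        using eng by (simp add: Bij_def bij_comp)
      ultimately show ?case using eng BijGroup_UNIV(3) by metis
    qed
    then show "w \<in> {foldr (\<circ>) ws id | ws. set ws \<subseteq> {s1, s2}}" by blast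
  qed
next
  have "foldr (\<circ>) ws id \<in> weyl_group \<and> foldr (\<circ>) ws id \<in> Bij UNIV"
    if "set ws \<subseteq> {s1, s2}" for ws
    using that
  proof (induction ws)
    case Nil
    have "\<one>\<^bsub>BijGroup UNIV\<^esub> \<in> weyl_group"
      unfolding weyl_group_def by (rule generate.one)
    moreover have "id \<in> Bij UNIV" by (simp add: Bij_def)
    moreover have "foldr (\<circ>) [] id = id" by simp
    ultimately show ?case unfolding BijGroup_UNIV(1) by metis
  next
    case (Cons s ws)
    then have s: "s \<in> {s1, s2}" and "set ws \<subseteq> {s1, s2}" by auto
    with Cons.IH have w: "foldr (\<circ>) ws id \<in> weyl_group"
      "foldr (\<circ>) ws id \<in> Bij UNIV" by blast+
    from s have "s \<in> Bij UNIV" using reflections_Bij by auto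
    moreover from s have "s \<in> weyl_group" unfolding weyl_group_def by (rule generate.incl)
    ultimately have "s \<circ> foldr (\<circ>) ws id \<in> weyl_group"
      using w generate.eng BijGroup_UNIV(3) unfolding weyl_group_def by metis
    moreover have "s \<circ> foldr (\<circ>) ws id \<in> Bij UNIV"
      using \<open>s \<in> Bij UNIV\<close> w by (simp add: Bij_def bij_comp)
    moreover have "foldr (\<circ>) (s # ws) id = s \<circ> foldr (\<circ>) ws id" by simp
    ultimately show ?case by metis
  qed
  then show "{foldr (\<circ>) ws id | ws. set ws \<subseteq> {s1, s2}} \<subseteq> weyl_group" by blast
qed

lemma finite_weyl_group: "finite weyl_group"
proof -
  define act :: "real \<times> real \<times> real \<times> real \<Rightarrow> weight \<Rightarrow> weight" where
    "act = (\<lambda>(p, q, r, t) v. (p * fst v + q * snd v, r * fst v + t * snd v))"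
  define A :: "(real \<times> real \<times> real \<times> real) set" where
    "A = {(- 2, 3, - 1, 1), (- 2, 3, - 1, 2), (- 1, 0, - 1, 1),
      (- 1, 0, 0, - 1), (- 1, 3, - 1, 2), (- 1, 3, 0, 1),
      (1, - 3, 0, - 1), (1, - 3, 1, - 2), (1, 0, 0, 1),
      (1, 0, 1, - 1), (2, - 3, 1, - 2), (2, - 3, 1, - 1)}"
  have 1: "s1 \<circ> act (p, q, r, t) = act (3 * r - p, 3 * t - q, r, t)" for p q r t
    by (simp add: fun_eq_iff act_def s1_def alpha1_def alpha2_def algebra_simps)
  have 2: "s2 \<circ> act (p, q, r, t) = act (p, q, p - r, q - t)" for p q r t
    by (simp add: fun_eq_iff act_def s2_def alpha1_def alpha2_def algebra_simps)
  have step: "s \<circ> w \<in> act ` A" if "s \<in> {s1, s2}" "w \<in> act ` A" for s w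
  proof -
    from that(2) obtain p q r t where "(p, q, r, t) \<in> A" "w = act (p, q, r, t)" by auto
    moreover from this(1)
    have "(3 * r - p, 3 * t - q, r, t) \<in> A \<and> (p, q, p - r, q - t) \<in> A"
      unfolding A_def insert_iff empty_iff prod.inject by (elim disjE conjE FalseE) simp_all
    ultimately show ?thesis using that(1) 1 2 by (metis image_eqI insert_iff empty_iff)
  qed
  have "id = act (1, 0, 0, 1)" by (simp add: fun_eq_iff act_def)
  moreover have "(1, 0, 0, 1) \<in> A" by (simp add: A_def)
  ultimately have id: "id \<in> act ` A" by blast
  have "foldr (\<circ>) ws id \<in> act ` A" if "set ws \<subseteq> {s1, s2}" for ws
    using that
  proof (induction ws)
    case Nil
    have "foldr (\<circ>) [] id = id" by simp
    with id show ?case by metis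
  next
    case (Cons s ws)
    then have "s \<in> {s1, s2}" and "set ws \<subseteq> {s1, s2}" by auto
    with Cons.IH have "s \<circ> foldr (\<circ>) ws id \<in> act ` A" by (intro step)
    moreover have "foldr (\<circ>) (s # ws) id = s \<circ> foldr (\<circ>) ws id" by simp
    ultimately show ?case by metis
  qed
  then have "weyl_group \<subseteq> act ` A" unfolding weyl_group_eq_words by blast
  moreover have "finite (act ` A)" by (simp add: A_def)
  ultimately show ?thesis by (rule finite_subset)
qed

text \<open>
  In \<^term>\<open>kostant_q\<close> the function under \<^term>\<open>Abs_poly\<close> has finite support and takes
  cardinalities of finite sets, so the coefficients are the intended ones.
\<close>

lemma finite_kostant_partitions: "finite (kostant_partitions i \<xi>)"
proof -
  have "kostant_partitions i \<xi> \<subseteq> mset ` {xs. set xs \<subseteq> pos_roots \<and> length xs = i}"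
  proof
    fix M assume M: "M \<in> kostant_partitions i \<xi>"
    obtain xs where "mset xs = M" using ex_mset by blast
    with M show "M \<in> mset ` {xs. set xs \<subseteq> pos_roots \<and> length xs = i}"
      unfolding kostant_partitions_def by auto
  qed
  moreover have "finite pos_roots" by (simp add: pos_roots_def)
  then have "finite (mset ` {xs. set xs \<subseteq> pos_roots \<and> length xs = i})"
    by (intro finite_imageI finite_lists_length_eq)
  ultimately show ?thesis by (rule finite_subset)
qed

lemma coeff_kostant_q: "coeff (kostant_q \<xi>) i = int (card (kostant_partitions i \<xi>))"
proof -
  have height: "real (size M) \<le> fst (\<Sum>\<^sub># M) + snd (\<Sum>\<^sub># M)"
    if "set_mset M \<subseteq> pos_roots" for M :: "weight multiset"
    using that
  proof (induction M)
    case (add a M)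
    then have "a \<in> pos_roots" by simp
    then have "1 \<le> fst a + snd a"
      unfolding pos_roots_def alpha1_def alpha2_def by auto
    with add show ?case by simp
  qed simp
  have "kostant_partitions k \<xi> = {}" if "nat \<lceil>fst \<xi> + snd \<xi>\<rceil> < k" for k
  proof -
    have "fst \<xi> + snd \<xi> < real k" using that by linarith
    then have "size M \<noteq> k" if "set_mset M \<subseteq> pos_roots" "\<Sum>\<^sub># M = \<xi>" for M
      using height[OF that(1)] that(2) by auto
    then show ?thesis unfolding kostant_partitions_def by blast
  qed
  then have "\<forall>\<^sub>\<infinity>k. int (card (kostant_partitions k \<xi>)) = 0"
    unfolding MOST_nat by (metis card.empty of_nat_0)
  then show ?thesis by (simp add: kostant_q_def Abs_poly_inverse)
qed

end

theory Submission
  imports Defs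
begin

text \<open>
  Two facts carry the result. First, \<open>\<wp>\<^sub>q\<close> of a root lattice element with coordinates
  \<open>(u, w)\<close> is nonzero exactly when \<open>u, w \<ge> 0\<close>: every positive root has nonnegative coordinates,
  and conversely \<open>u\<close> copies of \<open>\<alpha>\<^sub>1\<close> together with \<open>w\<close> copies of \<open>\<alpha>\<^sub>2\<close> form a partition
  (lemma \<open>kostant_q_eq_0_iff\<close>).

  Secondly, with \<open>M = m + 1\<close> and \<open>N = n + 1\<close>, the vector \<open>\<lambda> + \<rho>\<close> has the coordinates
  \<open>(2M + 3N, M + 2N)\<close>, and in its Weyl orbit only five vectors have two positive coordinates:
  its images under \<open>1\<close>, \<open>s\<^sub>1\<close>, \<open>s\<^sub>2\<close>, \<open>s\<^sub>2s\<^sub>1\<close>, \<open>s\<^sub>1s\<^sub>2\<close>, in the order of \<open>P, Q, R, S, T\<close>.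
  Both coordinates of \<open>\<mu> + \<rho>\<close> are positive as well, so the other seven Weyl group elements
  contribute zero. The remaining signs are determinants, which gives
  \<open>m\<^sub>q(\<lambda>, \<mu>) = P - Q - R + S + T\<close> for all \<open>m, n, x, y\<close> (lemma \<open>q_mult_eq_five_terms\<close>).

  The case distinction then only records which of the five terms vanish. The inequalities
  \<open>c \<le> a\<close>, \<open>f \<le> c\<close>, \<open>d \<le> b\<close>, \<open>e \<le> d\<close>, the implication from \<open>e \<ge> 0\<close> to \<open>c \<ge> 0\<close> and the
  implication from \<open>f \<ge> 0\<close> to \<open>d \<ge> 0\<close> exclude every pattern of signs that the seven lines
  do not list, apart from those where all five polynomials are zero.
\<close>

section \<open>Vanishing of the partition function\<close>

lemma kostant_q_eq_0_if_negative:
  assumes "fst \<xi> < 0 \<or> snd \<xi> < 0"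
  shows "kostant_q \<xi> = 0"
proof -
  have nonneg: "0 \<le> fst (\<Sum>\<^sub># M) \<and> 0 \<le> snd (\<Sum>\<^sub># M)"
    if "set_mset M \<subseteq> pos_roots" for M :: "weight multiset"
    using that
  proof (induction M)
    case (add r M)
    then have "r \<in> pos_roots" by simp
    then have "0 \<le> fst r \<and> 0 \<le> snd r"
      unfolding pos_roots_def alpha1_def alpha2_def by auto
    with add show ?case by simp
  qed simp
  have "kostant_partitions i \<xi> = {}" for i
  proof (rule equals0I)
    fix M assume "M \<in> kostant_partitions i \<xi>"
    then have "set_mset M \<subseteq> pos_roots" "\<Sum>\<^sub># M = \<xi>"
      by (simp_all add: kostant_partitions_def)
    then show False using nonneg[of M] assms by auto
  qed
  then show ?thesis
    by (intro poly_eqI) (simp add: coeff_kostant_q)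
qed

lemma kostant_q_nonzero_if_nonneg:
  "kostant_q (real u *\<^sub>R alpha1 + real w *\<^sub>R alpha2) \<noteq> 0"
proof -
  let ?\<xi> = "real u *\<^sub>R alpha1 + real w *\<^sub>R alpha2"
  let ?M = "replicate_mset u alpha1 + replicate_mset w alpha2"
  have rep: "\<Sum>\<^sub># (replicate_mset k r) = real k *\<^sub>R r" for k and r :: weight
    by (induction k) (simp_all add: scaleR_left_distrib)
  have "set_mset ?M \<subseteq> pos_roots"
    by (auto simp: pos_roots_def)
  then have "?M \<in> kostant_partitions (u + w) ?\<xi>"
    unfolding kostant_partitions_def by (simp add: rep)
  then have "card (kostant_partitions (u + w) ?\<xi>) \<noteq> 0"
    using finite_kostant_partitions by (metis card_0_eq empty_iff)
  then have "coeff (kostant_q ?\<xi>) (u + w) \<noteq> 0"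
    by (simp add: coeff_kostant_q)
  then show ?thesis by auto
qed

lemma kostant_q_eq_0_iff:
  fixes u w :: int
  shows "kostant_q (real_of_int u *\<^sub>R alpha1 + real_of_int w *\<^sub>R alpha2) = 0 \<longleftrightarrow> u < 0 \<or> w < 0"
proof
  assume "u < 0 \<or> w < 0"
  then show "kostant_q (real_of_int u *\<^sub>R alpha1 + real_of_int w *\<^sub>R alpha2) = 0"
    by (intro kostant_q_eq_0_if_negative) (simp add: alpha1_def alpha2_def)
next
  assume *: "kostant_q (real_of_int u *\<^sub>R alpha1 + real_of_int w *\<^sub>R alpha2) = 0"
  show "u < 0 \<or> w < 0"
  proof (rule ccontr)
    assume "\<not> (u < 0 \<or> w < 0)"
    then have "real (nat u) = real_of_int u" "real (nat w) = real_of_int w" by simp_all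
    then show False
      using kostant_q_nonzero_if_nonneg[of "nat u" "nat w"] * by simp
  qed
qed

section \<open>The Weyl group\<close>

lemma s1_Pair: "s1 (u, w) = (3 * w - u, w)"
  by (simp add: s1_def alpha1_def alpha2_def)

lemma s2_Pair: "s2 (u, w) = (u, u - w)"
  by (simp add: s2_def alpha1_def alpha2_def)

text \<open>
  The length enters only through its parity, and parity is visible in the determinant: each
  simple reflection has determinant \<open>-1\<close>, so all words for one group element have lengths of
  the same parity. Hence any word, reduced or not, yields the sign.
\<close>

lemma sign_weyl_length:
  assumes "set ws \<subseteq> {s1, s2}"
  shows "(-1 :: 'a :: comm_ring_1) ^ weyl_length (foldr (\<circ>) ws id) = (-1) ^ length ws"
proof -
  define det :: "(weight \<Rightarrow> weight) \<Rightarrow> real" where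
    "det g = fst (g alpha1) * snd (g alpha2) - fst (g alpha2) * snd (g alpha1)" for g
  have det_step: "det (s \<circ> g) = - det g" if "s \<in> {s1, s2}" for s g
    using that
    by (cases "g alpha1"; cases "g alpha2") (auto simp: det_def s1_Pair s2_Pair algebra_simps)
  have det_id: "det id = 1"
    by (simp add: det_def alpha1_def alpha2_def)
  have det_word: "det (foldr (\<circ>) us id) = (-1) ^ length us" if "set us \<subseteq> {s1, s2}" for us
    using that by (induction us) (simp_all add: det_id det_step)
  obtain vs where vs: "set vs \<subseteq> {s1, s2}"
      "length vs = weyl_length (foldr (\<circ>) ws id)" "foldr (\<circ>) ws id = foldr (\<circ>) vs id"
  proof -
    let ?word = "\<lambda>k. \<exists>vs. set vs \<subseteq> {s1, s2} \<and> length vs = k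
        \<and> foldr (\<circ>) ws id = foldr (\<circ>) vs id"
    have "?word (length ws)" using assms by (intro exI[of _ ws] conjI refl)
    then have "?word (Least ?word)" by (rule LeastI)
    then show ?thesis
      using that unfolding weyl_length_def by (elim exE conjE)
  qed
  have "(-1 :: real) ^ length vs = (-1) ^ length ws"
    using det_word[OF vs(1)] det_word[OF assms] vs(3) by simp
  then have "even (length vs) \<longleftrightarrow> even (length ws)"
    by (auto simp: minus_one_power_iff split: if_splits)
  then show ?thesis
    by (simp add: vs(2)[symmetric] minus_one_power_iff)
qed

text \<open>
  The braid relation \<open>(s\<^sub>1s\<^sub>2)\<^sup>3 = (s\<^sub>2s\<^sub>1)\<^sup>3\<close> and the involutivity of \<open>s\<^sub>1\<close>, \<open>s\<^sub>2\<close> reduce every word to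
  an alternating word of length at most six. The list serves to discard the Weyl group
  elements without contribution.
\<close>

lemma weyl_group_cases:
  assumes "\<sigma> \<in> weyl_group"
  shows "\<sigma> \<in> {id, s1, s2, s1 \<circ> s2, s2 \<circ> s1, s1 \<circ> s2 \<circ> s1, s2 \<circ> s1 \<circ> s2,
    s1 \<circ> s2 \<circ> s1 \<circ> s2, s2 \<circ> s1 \<circ> s2 \<circ> s1, s1 \<circ> s2 \<circ> s1 \<circ> s2 \<circ> s1, s2 \<circ> s1 \<circ> s2 \<circ> s1 \<circ> s2,
    s1 \<circ> s2 \<circ> s1 \<circ> s2 \<circ> s1 \<circ> s2}" (is "_ \<in> ?A")
proof -
  have cancel: "s1 \<circ> (s1 \<circ> g) = g" "s2 \<circ> (s2 \<circ> g) = g" for g :: "weight \<Rightarrow> weight"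
    using reflections_involutive by (simp_all add: comp_assoc[symmetric])
  have braid: "s2 \<circ> (s1 \<circ> (s2 \<circ> (s1 \<circ> (s2 \<circ> s1)))) = s1 \<circ> (s2 \<circ> (s1 \<circ> (s2 \<circ> (s1 \<circ> s2))))"
    by (simp add: fun_eq_iff s1_Pair s2_Pair)
  have braid': "s2 \<circ> (s1 \<circ> (s2 \<circ> (s1 \<circ> (s2 \<circ> (s1 \<circ> s2))))) = s1 \<circ> (s2 \<circ> (s1 \<circ> (s2 \<circ> s1)))"
    by (simp add: fun_eq_iff s1_Pair s2_Pair)
  have step: "s \<circ> g \<in> ?A" if "s \<in> {s1, s2}" "g \<in> ?A" for s g
    using that unfolding insert_iff empty_iff comp_assoc
    by (elim disjE FalseE) (simp_all add: cancel braid braid' reflections_involutive)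
  have "foldr (\<circ>) ws id \<in> ?A" if "set ws \<subseteq> {s1, s2}" for ws
    using that
  proof (induction ws)
    case (Cons s ws)
    then have "s \<in> {s1, s2}" and "set ws \<subseteq> {s1, s2}" by auto
    with Cons.IH have "s \<circ> foldr (\<circ>) ws id \<in> ?A" by (intro step)
    moreover have "foldr (\<circ>) (s # ws) id = s \<circ> foldr (\<circ>) ws id" by simp
    ultimately show ?case by (rule ssubst[rotated])
  qed simp
  with assms show ?thesis unfolding weyl_group_eq_words by blast
qed

section \<open>The weight multiplicity\<close>

text \<open>
  For strictly dominant \<open>v\<close>, the seven remaining Weyl group elements send \<open>v\<close> to vectors with
  a negative coordinate, and subtracting \<open>w\<close> keeps that coordinate negative.
\<close>

lemma kostant_q_orbit_eq_0:
  fixes p r :: real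
  assumes "\<sigma> \<in> weyl_group" "\<sigma> \<notin> {id, s1, s2, s1 \<circ> s2, s2 \<circ> s1}"
    and "v = p *\<^sub>R varpi1 + r *\<^sub>R varpi2" "0 < p" "0 < r" "0 \<le> fst w" "0 \<le> snd w"
  shows "kostant_q (\<sigma> v - w) = 0"
proof -
  have v: "v = (2 * p + 3 * r, p + 2 * r)"
    by (simp add: assms(3) varpi1_def varpi2_def alpha1_def alpha2_def)
  have "fst (\<sigma> v) < 0 \<or> snd (\<sigma> v) < 0"
    using weyl_group_cases[OF assms(1)] assms(2) \<open>0 < p\<close> \<open>0 < r\<close>
    unfolding insert_iff empty_iff v
    by (elim disjE FalseE) (simp_all add: s1_Pair s2_Pair)
  then show ?thesis
    using \<open>0 \<le> fst w\<close> \<open>0 \<le> snd w\<close> by (intro kostant_q_eq_0_if_negative) auto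
qed

lemma q_mult_eq_five_terms:
  fixes m n x y :: nat
  assumes "lam = real m *\<^sub>R varpi1 + real n *\<^sub>R varpi2"
    and "mu = real x *\<^sub>R varpi1 + real y *\<^sub>R varpi2"
  shows "q_mult lam mu =
      kostant_q (lam + rho - (mu + rho))
    - kostant_q (s1 (lam + rho) - (mu + rho))
    - kostant_q (s2 (lam + rho) - (mu + rho))
    + kostant_q ((s2 \<circ> s1) (lam + rho) - (mu + rho))
    + kostant_q ((s1 \<circ> s2) (lam + rho) - (mu + rho))"
proof -
  let ?C = "{id, s1, s2, s1 \<circ> s2, s2 \<circ> s1}"
  let ?term = "\<lambda>\<sigma>. (-1) ^ weyl_length \<sigma> * kostant_q (\<sigma> (lam + rho) - (mu + rho))"
  have "foldr (\<circ>) ws id \<in> weyl_group" if "set ws \<subseteq> {s1, s2}" for ws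
    unfolding weyl_group_eq_words by (rule CollectI, rule exI[of _ ws], rule conjI[OF refl that])
  from this[of "[]"] this[of "[s1]"] this[of "[s2]"] this[of "[s1, s2]"] this[of "[s2, s1]"]
  have "?C \<subseteq> weyl_group" by simp
  have sign: "(-1 :: int poly) ^ weyl_length id = 1"
      "(-1 :: int poly) ^ weyl_length s1 = -1" "(-1 :: int poly) ^ weyl_length s2 = -1"
      "(-1 :: int poly) ^ weyl_length (s1 \<circ> s2) = 1"
      "(-1 :: int poly) ^ weyl_length (s2 \<circ> s1) = 1"
    using sign_weyl_length[of "[]", where 'a = "int poly"]
      sign_weyl_length[of "[s1]", where 'a = "int poly"]
      sign_weyl_length[of "[s2]", where 'a = "int poly"]
      sign_weyl_length[of "[s1, s2]", where 'a = "int poly"]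
      sign_weyl_length[of "[s2, s1]", where 'a = "int poly"]
    by simp_all
  \<comment> \<open>The five elements are told apart by their values at the regular vector \<open>\<rho> = (5, 3)\<close>.\<close>
  have "distinct (map (\<lambda>\<sigma>. \<sigma> (5, 3)) [id, s1, s2, s1 \<circ> s2, s2 \<circ> s1])"
    by (simp add: s1_Pair s2_Pair)
  then have "distinct [id, s1, s2, s1 \<circ> s2, s2 \<circ> s1]"
    by (rule distinct_map[THEN iffD1, THEN conjunct1])
  then have five: "(\<Sum>\<sigma>\<in>?C. ?term \<sigma>) =
      ?term id + (?term s1 + (?term s2 + (?term (s1 \<circ> s2) + ?term (s2 \<circ> s1))))"
    by simp
  have lam: "lam + rho = (real m + 1) *\<^sub>R varpi1 + (real n + 1) *\<^sub>R varpi2"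
    by (simp add: assms(1) rho_eq(1) scaleR_left_distrib)
  have mu: "0 \<le> fst (mu + rho)" "0 \<le> snd (mu + rho)"
    by (simp_all add: assms(2) rho_eq(1) varpi1_def varpi2_def alpha1_def alpha2_def)
  have "q_mult lam mu = (\<Sum>\<sigma>\<in>?C. ?term \<sigma>)"
    unfolding q_mult_def
  proof (rule sum.mono_neutral_right[OF finite_weyl_group \<open>?C \<subseteq> weyl_group\<close>], rule ballI)
    fix \<sigma> assume "\<sigma> \<in> weyl_group - ?C"
    then have "kostant_q (\<sigma> (lam + rho) - (mu + rho)) = 0"
      by (intro kostant_q_orbit_eq_0[OF _ _ lam _ _ mu]) auto
    then show "?term \<sigma> = 0" by simp
  qed
  then show ?thesis
    unfolding five sign by simp
qed

theorem theorem1p1: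
  fixes m n x y :: nat
    and lam mu :: weight
    and a b c d e f :: int
    and P Q R S T :: "int poly"
  assumes "lam = real m *\<^sub>R varpi1 + real n *\<^sub>R varpi2"
    and "mu = real x *\<^sub>R varpi1 + real y *\<^sub>R varpi2"
    and "a = 2 * int m + 3 * int n - 2 * int x - 3 * int y"
    and "b = int m + 2 * int n - int x - 2 * int y"
    and "c = int m + 3 * int n - 2 * int x - 3 * int y - 1"
    and "d = int m + int n - int x - 2 * int y - 1"
    and "e = int n - int x - 2 * int y - 2"
    and "f = int m - 2 * int x - 3 * int y - 4"
    and "P = kostant_q (real_of_int a *\<^sub>R alpha1 + real_of_int b *\<^sub>R alpha2)"
    and "Q = kostant_q (real_of_int c *\<^sub>R alpha1 + real_of_int b *\<^sub>R alpha2)"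
    and "R = kostant_q (real_of_int a *\<^sub>R alpha1 + real_of_int d *\<^sub>R alpha2)"
    and "S = kostant_q (real_of_int c *\<^sub>R alpha1 + real_of_int e *\<^sub>R alpha2)"
    and "T = kostant_q (real_of_int f *\<^sub>R alpha1 + real_of_int d *\<^sub>R alpha2)"
  shows
    "let C1 = (a \<in> \<nat> \<and> b \<in> \<nat> \<and> c \<in> \<nat> \<and> d \<in> \<nat> \<and> e \<in> \<nat> \<and> f \<in> \<nat>);
         C2 = (a \<in> \<nat> \<and> b \<in> \<nat> \<and> c \<in> \<nat> \<and> d \<in> \<nat> \<and> e \<in> \<nat> \<and> f \<notin> \<nat>);
         C3 = (a \<in> \<nat> \<and> b \<in> \<nat> \<and> c \<in> \<nat> \<and> d \<in> \<nat> \<and> f \<in> \<nat> \<and> e \<notin> \<nat>);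
         C4 = (a \<in> \<nat> \<and> b \<in> \<nat> \<and> c \<in> \<nat> \<and> d \<in> \<nat> \<and> e \<notin> \<nat> \<and> f \<notin> \<nat>);
         C5 = (a \<in> \<nat> \<and> b \<in> \<nat> \<and> c \<in> \<nat> \<and> d \<notin> \<nat> \<and> e \<notin> \<nat> \<and> f \<notin> \<nat>);
         C6 = (a \<in> \<nat> \<and> b \<in> \<nat> \<and> d \<in> \<nat> \<and> c \<notin> \<nat> \<and> e \<notin> \<nat> \<and> f \<notin> \<nat>);
         C7 = (a \<in> \<nat> \<and> b \<in> \<nat> \<and> c \<notin> \<nat> \<and> d \<notin> \<nat> \<and> e \<notin> \<nat> \<and> f \<notin> \<nat>)
     in
       q_mult lam mu =
         (if C1 then P - Q - R + S + T
          else if C2 then P - Q - R + S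
          else if C3 then P - Q - R + T
          else if C4 then P - Q - R
          else if C5 then P - Q
          else if C6 then P - R
          else if C7 then P
          else 0) \<and>
       (C1 \<longleftrightarrow> P \<noteq> 0 \<and> Q \<noteq> 0 \<and> R \<noteq> 0 \<and> S \<noteq> 0 \<and> T \<noteq> 0) \<and>
       (C2 \<longleftrightarrow> P \<noteq> 0 \<and> Q \<noteq> 0 \<and> R \<noteq> 0 \<and> S \<noteq> 0 \<and> T = 0) \<and>
       (C3 \<longleftrightarrow> P \<noteq> 0 \<and> Q \<noteq> 0 \<and> R \<noteq> 0 \<and> S = 0 \<and> T \<noteq> 0) \<and>
       (C4 \<longleftrightarrow> P \<noteq> 0 \<and> Q \<noteq> 0 \<and> R \<noteq> 0 \<and> S = 0 \<and> T = 0) \<and>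
       (C5 \<longleftrightarrow> P \<noteq> 0 \<and> Q \<noteq> 0 \<and> R = 0 \<and> S = 0 \<and> T = 0) \<and>
       (C6 \<longleftrightarrow> P \<noteq> 0 \<and> Q = 0 \<and> R \<noteq> 0 \<and> S = 0 \<and> T = 0) \<and>
       (C7 \<longleftrightarrow> P \<noteq> 0 \<and> Q = 0 \<and> R = 0 \<and> S = 0 \<and> T = 0) \<and>
       (\<not> (C1 \<or> C2 \<or> C3 \<or> C4 \<or> C5 \<or> C6 \<or> C7) \<longleftrightarrow>
          P = 0 \<and> Q = 0 \<and> R = 0 \<and> S = 0 \<and> T = 0)"
proof -
  have zero: "P = 0 \<longleftrightarrow> \<not> (0 \<le> a \<and> 0 \<le> b)" "Q = 0 \<longleftrightarrow> \<not> (0 \<le> c \<and> 0 \<le> b)"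
      "R = 0 \<longleftrightarrow> \<not> (0 \<le> a \<and> 0 \<le> d)" "S = 0 \<longleftrightarrow> \<not> (0 \<le> c \<and> 0 \<le> e)"
      "T = 0 \<longleftrightarrow> \<not> (0 \<le> f \<and> 0 \<le> d)"
    unfolding assms(9-13) kostant_q_eq_0_iff de_Morgan_conj not_le by (rule refl)+
  have "P = kostant_q (lam + rho - (mu + rho))"
      "Q = kostant_q (s1 (lam + rho) - (mu + rho))"
      "R = kostant_q (s2 (lam + rho) - (mu + rho))"
      "S = kostant_q ((s2 \<circ> s1) (lam + rho) - (mu + rho))"
      "T = kostant_q ((s1 \<circ> s2) (lam + rho) - (mu + rho))"
    unfolding assms rho_eq(2) varpi1_def varpi2_def alpha1_def alpha2_def
    by (rule arg_cong[where f = kostant_q], simp add: s1_Pair s2_Pair algebra_simps)+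
  then have mult: "q_mult lam mu = P - Q - R + S + T"
    using q_mult_eq_five_terms[OF assms(1,2)] by simp
  have nat: "k \<in> \<nat> \<longleftrightarrow> 0 \<le> k" for k :: int
    by (auto simp: Nats_altdef1)
  have order: "0 \<le> c \<longrightarrow> 0 \<le> a" "0 \<le> f \<longrightarrow> 0 \<le> c" "0 \<le> d \<longrightarrow> 0 \<le> b" "0 \<le> e \<longrightarrow> 0 \<le> d"
      "0 \<le> e \<longrightarrow> 0 \<le> c" "0 \<le> f \<longrightarrow> 0 \<le> d"
    unfolding assms(3-8) by linarith+
  \<comment> \<open>From here on only the truth values of the six sign conditions matter.\<close>
  obtain A B C D E F where sgn: "0 \<le> a \<longleftrightarrow> A" "0 \<le> b \<longleftrightarrow> B" "0 \<le> c \<longleftrightarrow> C" "0 \<le> d \<longleftrightarrow> D"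
      "0 \<le> e \<longleftrightarrow> E" "0 \<le> f \<longleftrightarrow> F"
    by blast
  show ?thesis
    using zero order unfolding Let_def mult nat sgn
    by (cases A; cases B; cases C; cases D; cases E; cases F) simp_all
qed

end
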